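(* Let $M$ be a $G$-graded secondful $R$-module. Then $\mathrm{Spec}_G^s(M)$ with the Zariski topology is a Noetherian topological space if and only if $\mathrm{Spec}_G(R/Ann_R(M))$ with the Zariski topology is a Noetherian topological space.
   Context: $G$ is an abelian group with identity $e$; all rings are commutative with unity $1$. A $G$-graded ring is a ring $R=\bigoplus_{g\in G}R_g$ with additive subgroups $R_g$ satisfying $R_gR_h\subseteq R_{gh}$; $h(R)=\bigcup_{g}R_g$. An ideal $I$ is graded ($I\lhd_G R$) if $I=\bigoplus_g (I\cap R_g)$. A graded prime ideal is a proper graded ideal $p$ such that for $a,b\in h(R)$, $ab\in p$ implies $a\in p$ or $b\in p$; $\mathrm{Spec}_G(R)$ is the set of all graded prime ideals, with the Zariski topology whose closed sets are $V_G^R(J)=\{p\in\mathrm{Spec}_G(R): J\subseteq p\}$, $J\lhd_G R$. A $G$-graded $R$-module is an $R$-module $M=\bigoplus_{g\in G}M_g$ with $R_gM_h\subseteq M_{gh}$; a submodule $N$ is graded ($N\leq_G M$) if $N=\bigoplus_g(N\cap M_g)$. $Ann_R(N)=\{r\in R: rN=0\}$; $Ann_R(M)$ is a graded ideal and $R/Ann_R(M)$ is $G$-graded in the natural way. A non-zero graded submodule $S$ of $M$ is graded second if for every $r\in h(R)$, $rS=S$ or $rS=0$ (then $Ann_R(S)$ is a graded prime ideal); $\mathrm{Spec}_G^s(M)$ is the set of all graded second submodules of $M$. The Zariski topology on $\mathrm{Spec}_G^s(M)$ has as closed sets $V_G^s(N)=\{S\in \mathrm{Spec}_G^s(M): Ann_R(N)\subseteq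 Ann_R(S)\}$, $N\leq_G M$. $M$ is graded secondful if the natural map $\phi:\mathrm{Spec}_G^s(M)\to \mathrm{Spec}_G(R/Ann_R(M))$, $S\mapsto Ann_R(S)/Ann_R(M)$, is surjective. A topological space is Noetherian if its closed sets satisfy the descending chain condition. *)

theory Defs
  imports "HOL-Algebra.Algebra" "HOL-Analysis.Abstract_Topology"
begin

section \<open>Gradings\<close>

text \<open>
  \<open>internal_direct_sum M K A N\<close>: inside the additive group of \<open>M\<close>, the additive subgroup \<open>N\<close> is
  the internal direct sum of the subgroups \<open>A i\<close>, \<open>i \<in> K\<close>.  That is, adding up finitely supported
  families is an isomorphism from the external direct sum of the \<open>A i\<close> onto \<open>N\<close>.
  (\<^const>\<open>gfinprod\<close> of the additive monoid is the sum over the support of the family; \<open>K\<close> may be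
  infinite.)  The structure \<open>M\<close> can be a ring or a module.
\<close>

definition internal_direct_sum ::
    "('a, 'm) ring_scheme \<Rightarrow> 'i set \<Rightarrow> ('i \<Rightarrow> 'a set) \<Rightarrow> 'a set \<Rightarrow> bool" where
  "internal_direct_sum M K A N \<longleftrightarrow>
     (\<forall>i\<in>K. additive_subgroup (A i) M) \<and> additive_subgroup N M \<and>
     (\<lambda>x. gfinprod (add_monoid M) x K)
       \<in> iso (sum_group K (\<lambda>i. (add_monoid M)\<lparr>carrier := A i\<rparr>)) ((add_monoid M)\<lparr>carrier := N\<rparr>)"

locale graded_ring = G?: comm_group G + R?: cring R
  for G :: "('g, 'x) monoid_scheme" (structure) and R :: "('a, 'y) ring_scheme" (structure)
    and A :: "'g \<Rightarrow> 'a set" +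
  assumes ring_direct_sum: "internal_direct_sum R (carrier G) A (carrier R)"
    and ring_degree_mult:
      "\<lbrakk>g \<in> carrier G; h \<in> carrier G; a \<in> A g; b \<in> A h\<rbrakk> \<Longrightarrow> a \<otimes>\<^bsub>R\<^esub> b \<in> A (g \<otimes>\<^bsub>G\<^esub> h)"

locale graded_module = graded_ring G R A + Module.module R M
  for G :: "('g, 'x) monoid_scheme" (structure) and R :: "('a, 'y) ring_scheme" (structure)
    and A :: "'g \<Rightarrow> 'a set"
    and M :: "('a, 'b, 'z) module_scheme" (structure) and B :: "'g \<Rightarrow> 'b set" +
  assumes module_direct_sum: "internal_direct_sum M (carrier G) B (carrier M)"
    and module_degree_smult:
      "\<lbrakk>g \<in> carrier G; h \<in> carrier G; a \<in> A g; x \<in> B h\<rbrakk> \<Longrightarrow> a \<odot>\<^bsub>M\<^esub> x \<in> B (g \<otimes>\<^bsub>G\<^esub> h)"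

definition homogeneous :: "('g, 'x) monoid_scheme \<Rightarrow> ('g \<Rightarrow> 'a set) \<Rightarrow> 'a set" where
  "homogeneous G A = (\<Union>g\<in>carrier G. A g)"

definition graded_ideal ::
    "('g, 'x) monoid_scheme \<Rightarrow> ('a, 'y) ring_scheme \<Rightarrow> ('g \<Rightarrow> 'a set) \<Rightarrow> 'a set \<Rightarrow> bool" where
  "graded_ideal G R A I \<longleftrightarrow>
     ideal I R \<and> internal_direct_sum R (carrier G) (\<lambda>g. I \<inter> A g) I"

definition graded_submodule ::
    "('g, 'x) monoid_scheme \<Rightarrow> ('a, 'y) ring_scheme \<Rightarrow> ('a, 'b, 'z) module_scheme
      \<Rightarrow> ('g \<Rightarrow> 'b set) \<Rightarrow> 'b set \<Rightarrow> bool" where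
  "graded_submodule G R M B N \<longleftrightarrow>
     submodule N R M \<and> internal_direct_sum M (carrier G) (\<lambda>g. N \<inter> B g) N"

text \<open>The natural grading of \<open>R Quot I\<close>, with homogeneous components \<open>(R\<^sub>g + I) / I\<close>.\<close>

definition quotient_grading ::
    "('a, 'y) ring_scheme \<Rightarrow> 'a set \<Rightarrow> ('g \<Rightarrow> 'a set) \<Rightarrow> 'g \<Rightarrow> 'a set set" where
  "quotient_grading R I A g = (\<lambda>r. I +>\<^bsub>R\<^esub> r) ` A g"


section \<open>Noetherian topological spaces\<close>

definition noetherian_space :: "'a topology \<Rightarrow> bool" where
  "noetherian_space T \<longleftrightarrow>
     (\<forall>C :: nat \<Rightarrow> 'a set. (\<forall>n. closedin T (C n)) \<and> decseq C \<longrightarrow> (\<exists>m. \<forall>n\<ge>m. C n = C m))"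


section \<open>The graded prime spectrum\<close>

definition graded_prime ::
    "('g, 'x) monoid_scheme \<Rightarrow> ('a, 'y) ring_scheme \<Rightarrow> ('g \<Rightarrow> 'a set) \<Rightarrow> 'a set \<Rightarrow> bool" where
  "graded_prime G R A p \<longleftrightarrow>
     graded_ideal G R A p \<and> p \<noteq> carrier R \<and>
     (\<forall>a\<in>homogeneous G A. \<forall>b\<in>homogeneous G A. a \<otimes>\<^bsub>R\<^esub> b \<in> p \<longrightarrow> a \<in> p \<or> b \<in> p)"

definition graded_Spec ::
    "('g, 'x) monoid_scheme \<Rightarrow> ('a, 'y) ring_scheme \<Rightarrow> ('g \<Rightarrow> 'a set) \<Rightarrow> 'a set set" where
  "graded_Spec G R A = {p. graded_prime G R A p}"

definition graded_V ::
    "('g, 'x) monoid_scheme \<Rightarrow> ('a, 'y) ring_scheme \<Rightarrow> ('g \<Rightarrow> 'a set) \<Rightarrow> 'a set \<Rightarrow> 'a set set" where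
  "graded_V G R A J = {p \<in> graded_Spec G R A. J \<subseteq> p}"

text \<open>
  Both Zariski topologies are specified by their open sets, the complements of the sets declared
  closed.
\<close>

definition graded_Zariski ::
    "('g, 'x) monoid_scheme \<Rightarrow> ('a, 'y) ring_scheme \<Rightarrow> ('g \<Rightarrow> 'a set) \<Rightarrow> 'a set topology" where
  "graded_Zariski G R A =
     topology (\<lambda>U. \<exists>J. graded_ideal G R A J \<and> U = graded_Spec G R A - graded_V G R A J)"


section \<open>The graded second spectrum\<close>

definition Ann ::
    "('a, 'y) ring_scheme \<Rightarrow> ('a, 'b, 'z) module_scheme \<Rightarrow> 'b set \<Rightarrow> 'a set" where
  "Ann R M N = {r \<in> carrier R. \<forall>x\<in>N. r \<odot>\<^bsub>M\<^esub> x = \<zero>\<^bsub>M\<^esub>}"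

definition graded_second ::
    "('g, 'x) monoid_scheme \<Rightarrow> ('a, 'y) ring_scheme \<Rightarrow> ('g \<Rightarrow> 'a set)
      \<Rightarrow> ('a, 'b, 'z) module_scheme \<Rightarrow> ('g \<Rightarrow> 'b set) \<Rightarrow> 'b set \<Rightarrow> bool" where
  "graded_second G R A M B S \<longleftrightarrow>
     graded_submodule G R M B S \<and> S \<noteq> {\<zero>\<^bsub>M\<^esub>} \<and>
     (\<forall>r\<in>homogeneous G A.
        (\<lambda>x. r \<odot>\<^bsub>M\<^esub> x) ` S = S \<or> (\<lambda>x. r \<odot>\<^bsub>M\<^esub> x) ` S = {\<zero>\<^bsub>M\<^esub>})"

definition second_Spec ::
    "('g, 'x) monoid_scheme \<Rightarrow> ('a, 'y) ring_scheme \<Rightarrow> ('g \<Rightarrow> 'a set)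
      \<Rightarrow> ('a, 'b, 'z) module_scheme \<Rightarrow> ('g \<Rightarrow> 'b set) \<Rightarrow> 'b set set" where
  "second_Spec G R A M B = {S. graded_second G R A M B S}"

definition second_V ::
    "('g, 'x) monoid_scheme \<Rightarrow> ('a, 'y) ring_scheme \<Rightarrow> ('g \<Rightarrow> 'a set)
      \<Rightarrow> ('a, 'b, 'z) module_scheme \<Rightarrow> ('g \<Rightarrow> 'b set) \<Rightarrow> 'b set \<Rightarrow> 'b set set" where
  "second_V G R A M B N = {S \<in> second_Spec G R A M B. Ann R M N \<subseteq> Ann R M S}"

definition second_Zariski ::
    "('g, 'x) monoid_scheme \<Rightarrow> ('a, 'y) ring_scheme \<Rightarrow> ('g \<Rightarrow> 'a set)
      \<Rightarrow> ('a, 'b, 'z) module_scheme \<Rightarrow> ('g \<Rightarrow> 'b set) \<Rightarrow> 'b set topology" where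
  "second_Zariski G R A M B =
     topology (\<lambda>U. \<exists>N. graded_submodule G R M B N \<and>
                       U = second_Spec G R A M B - second_V G R A M B N)"

text \<open>The natural map \<open>S \<mapsto> Ann\<^sub>R(S) / Ann\<^sub>R(M)\<close>, with values in the subsets of \<open>R Quot Ann\<^sub>R(M)\<close>.\<close>

definition natural_map ::
    "('a, 'y) ring_scheme \<Rightarrow> ('a, 'b, 'z) module_scheme \<Rightarrow> 'b set \<Rightarrow> 'a set set" where
  "natural_map R M S = (\<lambda>r. Ann R M (carrier M) +>\<^bsub>R\<^esub> r) ` Ann R M S"

definition graded_secondful ::
    "('g, 'x) monoid_scheme \<Rightarrow> ('a, 'y) ring_scheme \<Rightarrow> ('g \<Rightarrow> 'a set)
      \<Rightarrow> ('a, 'b, 'z) module_scheme \<Rightarrow> ('g \<Rightarrow> 'b set) \<Rightarrow> bool" where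
  "graded_secondful G R A M B \<longleftrightarrow>
     (\<forall>q \<in> graded_Spec G (R Quot Ann R M (carrier M)) (quotient_grading R (Ann R M (carrier M)) A).
        \<exists>S \<in> second_Spec G R A M B. natural_map R M S = q)"

end

theory Submission
  imports Defs
begin

text \<open>
  The annihilator of a graded submodule is a graded ideal, and the submodule \<open>(0 :\<^sub>M J)\<close> annihilated by
  a graded ideal \<open>J\<close> is graded.  Since \<open>J \<subseteq> Ann(S)\<close> iff \<open>Ann(0 :\<^sub>M J) \<subseteq> Ann(S)\<close>, the closed sets of the
  second spectrum are exactly the preimages of the closed sets of the prime spectrum of
  \<open>R / Ann(M)\<close> under the natural map: the Zariski topology of the second spectrum is the pullback
  topology.  A surjective map identifies the closed sets of its codomain with those of the
  pullback, so descending chains stabilise in one space iff they do in the other.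

  Gradings are handled through their coordinate projections: a subgroup is graded iff it is closed
  under the projections of the ambient group.
\<close>

section \<open>Direct sums and coordinate projections\<close>

text \<open>A direct sum decomposition of \<open>N\<close>, recorded by its coordinate maps instead
  of an isomorphism from an external sum. \<open>\<pi>\<close> is constrained only on indices in
  \<open>K\<close> and elements of \<open>N\<close>. Finite support is encoded by
  \<open>proj_expand\<close>: \<open>proj_finsum\<close> then forces the coordinates outside
  \<open>F\<close> to vanish.\<close>

locale homogeneous_projections = abelian_group M
  for M :: "('a, 'm) ring_scheme" (structure) and K :: "'i set" and A :: "'i \<Rightarrow> 'a set"
    and N :: "'a set" and \<pi> :: "'i \<Rightarrow> 'a \<Rightarrow> 'a" +
  assumes subgroup_A: "i \<in> K \<Longrightarrow> additive_subgroup (A i) M"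
    and subgroup_N: "additive_subgroup N M"
    and A_subset: "i \<in> K \<Longrightarrow> A i \<subseteq> N"
    and proj_closed: "\<lbrakk>i \<in> K; x \<in> N\<rbrakk> \<Longrightarrow> \<pi> i x \<in> A i"
    and proj_add: "\<lbrakk>i \<in> K; x \<in> N; y \<in> N\<rbrakk> \<Longrightarrow> \<pi> i (x \<oplus> y) = \<pi> i x \<oplus> \<pi> i y"
    and proj_homogeneous:
      "\<lbrakk>i \<in> K; j \<in> K; x \<in> A i\<rbrakk> \<Longrightarrow> \<pi> j x = (if j = i then x else \<zero>)"
    and proj_expand: "x \<in> N \<Longrightarrow> \<exists>F\<subseteq>K. finite F \<and> x = (\<Oplus>i\<in>F. \<pi> i x)"
begin

lemma A_carrier: "i \<in> K \<Longrightarrow> x \<in> A i \<Longrightarrow> x \<in> carrier M"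
  using additive_subgroup.a_subset[OF subgroup_A] by blast

lemma zero_A: "i \<in> K \<Longrightarrow> \<zero> \<in> A i"
  by (rule additive_subgroup.zero_closed[OF subgroup_A])

lemma proj_carrier: "i \<in> K \<Longrightarrow> x \<in> N \<Longrightarrow> \<pi> i x \<in> carrier M"
  using A_carrier proj_closed by blast

lemma proj_zero: "i \<in> K \<Longrightarrow> \<pi> i \<zero> = \<zero>"
  using proj_homogeneous[of i i "\<zero>"] zero_A by simp

text \<open>Independence of the components: additivity together with \<open>proj_homogeneous\<close>
  lets a projection act term by term, by induction on \<open>F\<close>.\<close>

lemma proj_finsum:
  assumes "finite F" "F \<subseteq> K" "\<And>i. i \<in> F \<Longrightarrow> f i \<in> A i" "j \<in> K"
  shows "(\<Oplus>i\<in>F. f i) \<in> N \<and> \<pi> j (\<Oplus>i\<in>F. f i) = (if j \<in> F then f j else \<zero>)"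
  using assms(1-3)
proof (induction F)
  case empty
  then show ?case
    using proj_zero[OF assms(4)] additive_subgroup.zero_closed[OF subgroup_N] by simp
next
  case (insert k F)
  have car: "f \<in> F \<rightarrow> carrier M" "f k \<in> carrier M"
    using insert.prems A_carrier by blast+
  have N: "f k \<in> N" using insert.prems A_subset by blast
  have IH: "(\<Oplus>i\<in>F. f i) \<in> N" "\<pi> j (\<Oplus>i\<in>F. f i) = (if j \<in> F then f j else \<zero>)"
    using insert by auto
  have sum: "(\<Oplus>i\<in>insert k F. f i) = f k \<oplus> (\<Oplus>i\<in>F. f i)"
    using insert car by simp
  have "\<pi> j (f k) = (if j = k then f k else \<zero>)"
    using proj_homogeneous[of k j "f k"] insert.prems assms(4) by auto
  then have "\<pi> j (\<Oplus>i\<in>insert k F. f i) = (if j \<in> insert k F then f j else \<zero>)"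
    unfolding sum proj_add[OF assms(4) N IH(1)] IH(2)
    using insert.hyps(2) insert.prems(2) car by (auto simp: Pi_iff)
  then show ?case
    unfolding sum using additive_subgroup.a_closed[OF subgroup_N N IH(1)] by simp
qed

text \<open>A subgroup contains the finite sum of components that \<open>proj_expand\<close>
  supplies. Read contrapositively, an element outside \<open>H\<close> has a homogeneous component
  outside \<open>H\<close>, which is what arguments with graded primes need.\<close>

lemma mem_subgroup_if_proj_mem:
  assumes "additive_subgroup H M" "x \<in> N" "\<And>i. i \<in> K \<Longrightarrow> \<pi> i x \<in> H"
  shows "x \<in> H"
proof -
  obtain F where F: "F \<subseteq> K" "finite F" "x = (\<Oplus>i\<in>F. \<pi> i x)"
    using proj_expand[OF assms(2)] by blast
  have "(\<Oplus>i\<in>F. \<pi> i x) \<in> H"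
    using F(2,1)
  proof (induction F)
    case empty
    then show ?case using additive_subgroup.zero_closed[OF assms(1)] by simp
  next
    case (insert k F)
    have "(\<lambda>i. \<pi> i x) \<in> F \<rightarrow> carrier M" "\<pi> k x \<in> carrier M"
      using insert.prems proj_carrier[OF _ assms(2)] by auto
    then show ?case
      using insert assms(3) additive_subgroup.a_closed[OF assms(1)] by simp
  qed
  then show ?thesis using F(3) by simp
qed

text \<open>Meant for identities additive in \<open>x\<close>, which then need checking only on
  homogeneous elements. The zero case starts the sum and covers an empty \<open>K\<close>.\<close>

lemma additive_induct [consumes 1, case_names add homogeneous zero]:
  assumes "x \<in> N"
    and add: "\<And>x y. \<lbrakk>x \<in> N; y \<in> N; P x; P y\<rbrakk> \<Longrightarrow> P (x \<oplus> y)"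
    and hom: "\<And>i x. \<lbrakk>i \<in> K; x \<in> A i\<rbrakk> \<Longrightarrow> P x"
    and zero: "P \<zero>"
  shows "P x"
proof -
  obtain F where F: "F \<subseteq> K" "finite F" "x = (\<Oplus>i\<in>F. \<pi> i x)"
    using proj_expand[OF assms(1)] by blast
  have "(\<Oplus>i\<in>F. \<pi> i x) \<in> N \<and> P (\<Oplus>i\<in>F. \<pi> i x)"
    using F(2,1)
  proof (induction F)
    case empty
    then show ?case using zero additive_subgroup.zero_closed[OF subgroup_N] by simp
  next
    case (insert k F)
    have "(\<lambda>i. \<pi> i x) \<in> F \<rightarrow> carrier M" "\<pi> k x \<in> carrier M" "\<pi> k x \<in> A k" "\<pi> k x \<in> N"
      using insert.prems proj_carrier[OF _ assms(1)] proj_closed[OF _ assms(1)] A_subset by auto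
    moreover have "P (\<pi> k x)" using insert.prems hom calculation(3) by auto
    ultimately show ?case
      using insert add additive_subgroup.a_closed[OF subgroup_N] by simp
  qed
  then show ?thesis using F(3) by simp
qed

end

section \<open>Equivalence of internal direct sums and systems of projections\<close>

context abelian_group
begin

text \<open>\<open>F\<close> may be any finite set containing the support, since the extra terms are
  zero; the sum over a possibly infinite \<open>K\<close> becomes an ordinary finite sum.\<close>

lemma gfinprod_eq_finsum:
  assumes "finite F" "F \<subseteq> K" "f \<in> K \<rightarrow> carrier G" "\<And>i. i \<in> K - F \<Longrightarrow> f i = \<zero>"
  shows "gfinprod (add_monoid G) f K = (\<Oplus>i\<in>F. f i)"
proof -
  have "gfinprod (add_monoid G) f K = gfinprod (add_monoid G) f F"
    by (rule add.gfinprod_mono_neutral_cong_right) (use assms in auto)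
  also have "\<dots> = (\<Oplus>i\<in>F. f i)"
    using assms by (intro add.gfinprod_eq_finprod) auto
  finally show ?thesis .
qed

lemma carrier_sum_group_subgroups:
  assumes "\<And>i. i \<in> K \<Longrightarrow> additive_subgroup (A i) G"
  shows "carrier (sum_group K (\<lambda>i. (add_monoid G)\<lparr>carrier := A i\<rparr>)) =
    {f \<in> \<Pi>\<^sub>E i\<in>K. A i. finite {i \<in> K. f i \<noteq> \<zero>}}"
proof -
  have "group ((add_monoid G)\<lparr>carrier := A i\<rparr>)" if "i \<in> K" for i
    using additive_subgroup.a_subgroup[OF assms[OF that]] subgroup.subgroup_is_group a_group by blast
  then show ?thesis by (subst carrier_sum_group) auto
qed

text \<open>Inverting the summation isomorphism sends an element to its family of components; the
  projection at \<open>i\<close> is the \<open>i\<close>-th entry of that family.\<close>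

lemma internal_direct_sum_imp_projections:
  assumes "internal_direct_sum G K A N"
  shows "\<exists>\<pi>. homogeneous_projections G K A N \<pi>"
proof -
  \<comment> \<open>\<open>S\<close> is the underlying set of the external direct sum and
    \<open>s\<close> the summation map.\<close>
  define S where "S = {f \<in> \<Pi>\<^sub>E i\<in>K. A i. finite {i \<in> K. f i \<noteq> \<zero>}}"
  define s where "s f = gfinprod (add_monoid G) f K" for f
  have A: "\<And>i. i \<in> K \<Longrightarrow> additive_subgroup (A i) G" and N: "additive_subgroup N G"
    and iso: "s \<in> iso (sum_group K (\<lambda>i. (add_monoid G)\<lparr>carrier := A i\<rparr>)) ((add_monoid G)\<lparr>carrier := N\<rparr>)"
    using assms unfolding internal_direct_sum_def s_def by auto
  note AD = additive_subgroup.a_subset[OF A] additive_subgroup.zero_closed[OF A]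
    additive_subgroup.a_closed[OF A]
  have S: "carrier (sum_group K (\<lambda>i. (add_monoid G)\<lparr>carrier := A i\<rparr>)) = S"
    unfolding S_def by (rule carrier_sum_group_subgroups[OF A])
  have bij: "bij_betw s S N"
    using iso unfolding iso_def S by simp
  have s_add: "s (\<lambda>i\<in>K. f i \<oplus> f' i) = s f \<oplus> s f'" if "f \<in> S" "f' \<in> S" for f f'
    using iso that unfolding iso_def hom_def S by simp
  have S_add: "(\<lambda>i\<in>K. f i \<oplus> f' i) \<in> S" if "f \<in> S" "f' \<in> S" for f f'
  proof -
    have "finite ({i \<in> K. f i \<noteq> \<zero>} \<union> {i \<in> K. f' i \<noteq> \<zero>})"
      using that unfolding S_def by auto
    then have "finite {i \<in> K. (\<lambda>i\<in>K. f i \<oplus> f' i) i \<noteq> \<zero>}"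
      by (rule finite_subset[rotated]) auto
    then show ?thesis using that AD(3) unfolding S_def by (auto simp: PiE_iff)
  qed
  define c where "c = inv_into S s"
  have c: "c x \<in> S" "s (c x) = x" if "x \<in> N" for x
    using bij_betw_inv_into_right[OF bij that] bij_betw_imp_surj_on[OF bij] that
    unfolding c_def by (auto intro: inv_into_into)
  have c_s: "c (s f) = f" if "f \<in> S" for f
    unfolding c_def using bij_betw_inv_into_left[OF bij that] .
  \<comment> \<open>The family concentrated at \<open>i\<close> sums to its single entry, so by
    injectivity it is the component family of a homogeneous element.\<close>
  have s_single: "(\<lambda>j\<in>K. if j = i then x else \<zero>) \<in> S"
      "s (\<lambda>j\<in>K. if j = i then x else \<zero>) = x" if "i \<in> K" "x \<in> A i" for i x
  proof -
    have "finite {j \<in> K. (\<lambda>j\<in>K. if j = i then x else \<zero>) j \<noteq> \<zero>}"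
      by (rule finite_subset[of _ "{i}"]) auto
    then show "(\<lambda>j\<in>K. if j = i then x else \<zero>) \<in> S"
      unfolding S_def using that AD by (auto simp: PiE_iff)
    have x: "x \<in> carrier G" using that AD by blast
    have "s (\<lambda>j\<in>K. if j = i then x else \<zero>) = (\<Oplus>j\<in>{i}. (\<lambda>j\<in>K. if j = i then x else \<zero>) j)"
      unfolding s_def using that x by (intro gfinprod_eq_finsum) auto
    then show "s (\<lambda>j\<in>K. if j = i then x else \<zero>) = x" using that x by simp
  qed
  have "homogeneous_projections G K A N (\<lambda>i x. c x i)"
  proof (intro homogeneous_projections.intro homogeneous_projections_axioms.intro abelian_group_axioms)
    show "additive_subgroup (A i) G" if "i \<in> K" for i by (rule A[OF that])
    show "additive_subgroup N G" by (rule N)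
    show "A i \<subseteq> N" if "i \<in> K" for i
    proof
      fix x assume "x \<in> A i"
      from bij_betwE[OF bij, rule_format, OF s_single(1)[OF that this]] s_single(2)[OF that this]
      show "x \<in> N" by simp
    qed
    show "c x i \<in> A i" if "i \<in> K" "x \<in> N" for i x
      using c(1)[OF that(2)] that(1) unfolding S_def by (auto simp: PiE_iff)
    show "c (x \<oplus> y) i = c x i \<oplus> c y i" if "i \<in> K" "x \<in> N" "y \<in> N" for i x y
    proof -
      \<comment> \<open>The pointwise sum of the two component families also sums to
        \<open>x \<oplus> y\<close>, and injectivity of \<open>s\<close> identifies it with
        \<open>c (x \<oplus> y)\<close>.\<close>
      have "s (\<lambda>i\<in>K. c x i \<oplus> c y i) = x \<oplus> y"
        using s_add[OF c(1)[OF that(2)] c(1)[OF that(3)]] c that by simp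
      then have "c (x \<oplus> y) = (\<lambda>i\<in>K. c x i \<oplus> c y i)"
        using c_s[OF S_add[OF c(1)[OF that(2)] c(1)[OF that(3)]]] by simp
      then show ?thesis using that by simp
    qed
    show "c x j = (if j = i then x else \<zero>)" if "i \<in> K" "j \<in> K" "x \<in> A i" for i j x
      using c_s[OF s_single(1)[OF that(1,3)]] s_single(2)[OF that(1,3)] that by simp
    show "\<exists>F\<subseteq>K. finite F \<and> x = (\<Oplus>i\<in>F. c x i)" if "x \<in> N" for x
    proof (intro exI conjI)
      let ?F = "{i \<in> K. c x i \<noteq> \<zero>}"
      show "?F \<subseteq> K" by auto
      show fin: "finite ?F" using c(1)[OF that] unfolding S_def by auto
      have "x = s (c x)" using c(2)[OF that] by simp
      also have "\<dots> = (\<Oplus>i\<in>?F. c x i)"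
        unfolding s_def using fin c(1)[OF that] AD(1) unfolding S_def
        by (intro gfinprod_eq_finsum) (auto simp: PiE_iff subset_iff)
      finally show "x = (\<Oplus>i\<in>?F. c x i)" .
    qed
  qed
  then show ?thesis by blast
qed

text \<open>The projections recover a family from its sum, which makes summation injective; the
  family of components of \<open>x\<close> sums to \<open>x\<close>, which makes it
  surjective.\<close>

lemma projections_imp_internal_direct_sum:
  assumes "homogeneous_projections G K A N \<pi>"
  shows "internal_direct_sum G K A N"
proof -
  interpret homogeneous_projections G K A N \<pi> by fact
  define S where "S = {f \<in> \<Pi>\<^sub>E i\<in>K. A i. finite {i \<in> K. f i \<noteq> \<zero>}}"
  define s where "s f = gfinprod (add_monoid G) f K" for f
  have S: "carrier (sum_group K (\<lambda>i. (add_monoid G)\<lparr>carrier := A i\<rparr>)) = S"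
    unfolding S_def by (rule carrier_sum_group_subgroups[OF subgroup_A])
  have s: "s f \<in> N" "\<And>j. j \<in> K \<Longrightarrow> \<pi> j (s f) = f j" if "f \<in> S" for f
  proof -
    let ?F = "{i \<in> K. f i \<noteq> \<zero>}"
    have f: "finite ?F" "\<And>i. i \<in> K \<Longrightarrow> f i \<in> A i" using that unfolding S_def by auto
    have eq: "s f = (\<Oplus>i\<in>?F. f i)"
      unfolding s_def using f A_carrier by (intro gfinprod_eq_finsum) auto
    show pj: "\<pi> j (s f) = f j" if "j \<in> K" for j
      unfolding eq using proj_finsum[OF f(1) _ _ that, of f] f(2) that by auto
    \<comment> \<open>\<open>proj_finsum\<close> has to be instantiated with some index
      \<open>j\<close> in \<open>K\<close>. For empty \<open>K\<close> the sum is zero, and this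
      fact takes over.\<close>
    have "\<zero> \<in> N" by (rule additive_subgroup.zero_closed[OF subgroup_N])
    then show "s f \<in> N"
      unfolding eq using proj_finsum[OF f(1), of f] f(2)
      by (cases "K = {}") auto
  qed
  have s_add: "s (\<lambda>i\<in>K. f i \<oplus> f' i) = s f \<oplus> s f'" if "f \<in> S" "f' \<in> S" for f f'
  proof -
    have "s (\<lambda>i\<in>K. f i \<oplus> f' i) = gfinprod (add_monoid G) (\<lambda>i. f i \<oplus> f' i) K"
      unfolding s_def using that A_carrier unfolding S_def
      by (intro add.gfinprod_cong) (auto simp: PiE_iff simp_implies_def)
    also have "\<dots> = s f \<oplus> s f'"
      unfolding s_def using that A_carrier add.gfinprod_distrib[of K f f'] unfolding S_def
      by (auto simp: PiE_iff Pi_iff)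
    finally show ?thesis .
  qed
  have "inj_on s S"
  proof (rule inj_onI)
    fix f f' assume ff: "f \<in> S" "f' \<in> S" "s f = s f'"
    show "f = f'"
    proof (rule PiE_ext)
      show "f \<in> Pi\<^sub>E K A" "f' \<in> Pi\<^sub>E K A" using ff unfolding S_def by auto
      show "f i = f' i" if "i \<in> K" for i using s(2)[OF ff(1) that] s(2)[OF ff(2) that] ff(3) by simp
    qed
  qed
  moreover have "x \<in> s ` S" if x: "x \<in> N" for x
  proof -
    obtain F where F: "F \<subseteq> K" "finite F" "x = (\<Oplus>i\<in>F. \<pi> i x)"
      using proj_expand[OF x] by blast
    \<comment> \<open>Projecting the expansion of \<open>x\<close> over \<open>F\<close> shows that
      components outside \<open>F\<close> vanish, so the component family has finite
      support.\<close>
    have z: "\<pi> j x = \<zero>" if "j \<in> K" "j \<notin> F" for j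
    proof -
      have "\<pi> j (\<Oplus>i\<in>F. \<pi> i x) = \<zero>"
        using proj_finsum[OF F(2,1) _ that(1), of "\<lambda>i. \<pi> i x"] that proj_closed[OF _ x] F(1)
        by auto
      then show ?thesis using F(3) by simp
    qed
    have fin: "finite {i \<in> K. (\<lambda>i\<in>K. \<pi> i x) i \<noteq> \<zero>}"
      by (rule finite_subset[OF _ F(2)]) (use z in auto)
    then have "(\<lambda>i\<in>K. \<pi> i x) \<in> S" unfolding S_def using proj_closed[OF _ x] by auto
    moreover have "s (\<lambda>i\<in>K. \<pi> i x) = (\<Oplus>i\<in>F. (\<lambda>i\<in>K. \<pi> i x) i)"
      unfolding s_def using F z proj_carrier[OF _ x] by (intro gfinprod_eq_finsum) auto
    moreover have "\<dots> = (\<Oplus>i\<in>F. \<pi> i x)"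
      using F(1) proj_carrier[OF _ x] by (intro finsum_cong') auto
    ultimately show ?thesis using F(3) by (metis imageI)
  qed
  ultimately have "bij_betw s S N"
    using s(1) unfolding bij_betw_def by blast
  then have "s \<in> iso (sum_group K (\<lambda>i. (add_monoid G)\<lparr>carrier := A i\<rparr>)) ((add_monoid G)\<lparr>carrier := N\<rparr>)"
    unfolding iso_def hom_def S using s(1) s_add by simp
  moreover have "s = (\<lambda>f. gfinprod (add_monoid G) f K)" by (simp add: s_def fun_eq_iff)
  ultimately show ?thesis
    unfolding internal_direct_sum_def using subgroup_A subgroup_N by simp
qed

end

text \<open>Components are unique, so those given by a grading of \<open>I\<close> agree with the
  ambient ones and \<open>I\<close> is stable under \<open>\<pi>\<close>. Conversely a stable
  \<open>I\<close> inherits the restrictions of \<open>\<pi>\<close>.\<close>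

lemma (in homogeneous_projections) internal_direct_sum_Int_iff:
  assumes "additive_subgroup I M" "I \<subseteq> N"
  shows "internal_direct_sum M K (\<lambda>i. I \<inter> A i) I \<longleftrightarrow> (\<forall>i\<in>K. \<forall>x\<in>I. \<pi> i x \<in> I)"
proof
  assume "internal_direct_sum M K (\<lambda>i. I \<inter> A i) I"
  then obtain \<rho> where "homogeneous_projections M K (\<lambda>i. I \<inter> A i) I \<rho>"
    using internal_direct_sum_imp_projections by blast
  then interpret I: homogeneous_projections M K "\<lambda>i. I \<inter> A i" I \<rho> .
  show "\<forall>i\<in>K. \<forall>x\<in>I. \<pi> i x \<in> I"
  proof (intro ballI)
    fix i x assume i: "i \<in> K" and x: "x \<in> I"
    obtain F where F: "F \<subseteq> K" "finite F" "x = (\<Oplus>i\<in>F. \<rho> i x)"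
      using I.proj_expand[OF x] by blast
    \<comment> \<open>The \<open>\<rho>\<close>-components of \<open>x\<close> are homogeneous in
      the ambient grading too, so \<open>\<pi> i\<close> picks out the \<open>i\<close>-th
      one.\<close>
    have "\<pi> i (\<Oplus>i\<in>F. \<rho> i x) = (if i \<in> F then \<rho> i x else \<zero>)"
      using proj_finsum[OF F(2,1) _ i, of "\<lambda>i. \<rho> i x"] I.proj_closed[OF _ x] F(1) by blast
    then show "\<pi> i x \<in> I"
      using F(3) I.proj_closed[OF i x] additive_subgroup.zero_closed[OF assms(1)] by auto
  qed
next
  assume *: "\<forall>i\<in>K. \<forall>x\<in>I. \<pi> i x \<in> I"
  have "homogeneous_projections M K (\<lambda>i. I \<inter> A i) I \<pi>"
  proof (intro homogeneous_projections.intro homogeneous_projections_axioms.intro abelian_group_axioms)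
    show "additive_subgroup (I \<inter> A i) M" if "i \<in> K" for i
      using add.subgroups_Inter_pair[OF additive_subgroup.a_subgroup[OF assms(1)]
          additive_subgroup.a_subgroup[OF subgroup_A[OF that]]]
      by (rule additive_subgroupI)
    show "\<pi> i x \<in> I \<inter> A i" if "i \<in> K" "x \<in> I" for i x
      using that * proj_closed assms(2) by blast
    show "\<pi> i (x \<oplus> y) = \<pi> i x \<oplus> \<pi> i y" if "i \<in> K" "x \<in> I" "y \<in> I" for i x y
      using that proj_add assms(2) by blast
    show "\<pi> j x = (if j = i then x else \<zero>)" if "i \<in> K" "j \<in> K" "x \<in> I \<inter> A i" for i j x
      using that by (intro proj_homogeneous) auto
    show "\<exists>F\<subseteq>K. finite F \<and> x = (\<Oplus>i\<in>F. \<pi> i x)" if "x \<in> I" for x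
      using that assms(2) by (intro proj_expand) auto
  qed (rule assms, simp)
  then show "internal_direct_sum M K (\<lambda>i. I \<inter> A i) I"
    by (rule projections_imp_internal_direct_sum)
qed

section \<open>The graded prime spectrum\<close>

text \<open>Projections descend along a surjective homomorphism once they preserve its kernel, which
  is what \<open>ker\<close> demands.\<close>

lemma (in abelian_group_hom) image_homogeneous_projections:
  assumes pr: "homogeneous_projections G K A (carrier G) \<pi>"
    and surj: "h ` carrier G = carrier H"
    and ker: "\<And>i x. \<lbrakk>i \<in> K; x \<in> carrier G; h x = \<zero>\<^bsub>H\<^esub>\<rbrakk> \<Longrightarrow> h (\<pi> i x) = \<zero>\<^bsub>H\<^esub>"
  obtains \<rho> where "homogeneous_projections H K (\<lambda>i. h ` A i) (carrier H) \<rho>"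
    and "\<And>i x. \<lbrakk>i \<in> K; x \<in> carrier G\<rbrakk> \<Longrightarrow> \<rho> i (h x) = h (\<pi> i x)"
proof
  interpret P: homogeneous_projections G K A "carrier G" \<pi> by fact
  \<comment> \<open>The projection is applied to an arbitrarily chosen preimage; \<open>wd\<close>
    shows that the choice does not matter.\<close>
  define \<rho> where "\<rho> i Q = h (\<pi> i (SOME x. x \<in> carrier G \<and> h x = Q))" for i Q
  have wd: "h (\<pi> i x) = h (\<pi> i y)"
    if i: "i \<in> K" and xy: "x \<in> carrier G" "y \<in> carrier G" "h x = h y" for i x y
  proof -
    \<comment> \<open>Two preimages of one element differ by an element of the kernel, whose
      projections stay in the kernel.\<close>
    define z where "z = x \<oplus> \<ominus> y"
    have z: "z \<in> carrier G" "h z = \<zero>\<^bsub>H\<^esub>" unfolding z_def using xy H.r_neg by auto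
    have x: "x = z \<oplus> y" unfolding z_def using xy by (simp add: G.a_assoc G.l_neg)
    have "h (\<pi> i x) = h (\<pi> i z) \<oplus>\<^bsub>H\<^esub> h (\<pi> i y)"
      unfolding x using P.proj_add[OF i z(1) xy(2)] P.proj_carrier[OF i] z xy by simp
    then show ?thesis using ker[OF i z] P.proj_carrier[OF i] xy by simp
  qed
  show \<rho>: "\<rho> i (h x) = h (\<pi> i x)" if "i \<in> K" "x \<in> carrier G" for i x
  proof -
    have "\<exists>y. y \<in> carrier G \<and> h y = h x" using that by blast
    from someI_ex[OF this] show ?thesis unfolding \<rho>_def using wd that by blast
  qed
  have h_finsum: "h (\<Oplus>i\<in>F. f i) = (\<Oplus>\<^bsub>H\<^esub>i\<in>F. h (f i))" if "finite F" "F \<subseteq> K" "f \<in> F \<rightarrow> carrier G" for F f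
    using that by (induction F) (auto simp: Pi_iff)
  show "homogeneous_projections H K (\<lambda>i. h ` A i) (carrier H) \<rho>"
  proof (intro homogeneous_projections.intro homogeneous_projections_axioms.intro H.abelian_group_axioms)
    show "additive_subgroup (h ` A i) H" if "i \<in> K" for i
      using group_hom.subgroup_img_is_subgroup[OF a_group_hom]
        additive_subgroup.a_subgroup[OF P.subgroup_A[OF that]] by (intro additive_subgroupI) blast
    show "additive_subgroup (carrier H) H"
      using H.add.subgroup_self by (intro additive_subgroupI) simp
    show "h ` A i \<subseteq> carrier H" if "i \<in> K" for i
      using P.A_carrier[OF that] by auto
    show "\<rho> i Q \<in> h ` A i" if "i \<in> K" "Q \<in> carrier H" for i Q
      using that(2) \<rho>[OF that(1)] P.proj_closed[OF that(1)] unfolding surj[symmetric] by auto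
    show "\<rho> i (Q \<oplus>\<^bsub>H\<^esub> Y) = \<rho> i Q \<oplus>\<^bsub>H\<^esub> \<rho> i Y" if i: "i \<in> K" and QY: "Q \<in> carrier H" "Y \<in> carrier H" for i Q Y
    proof -
      obtain x y where xy: "x \<in> carrier G" "Q = h x" "y \<in> carrier G" "Y = h y"
        using QY unfolding surj[symmetric] by blast
      have "\<rho> i (h (x \<oplus> y)) = h (\<pi> i (x \<oplus> y))" by (rule \<rho>[OF i]) (use xy in simp)
      also have "\<dots> = h (\<pi> i x) \<oplus>\<^bsub>H\<^esub> h (\<pi> i y)"
        using P.proj_add[OF i] P.proj_carrier[OF i] xy by simp
      finally have "\<rho> i (h (x \<oplus> y)) = h (\<pi> i x) \<oplus>\<^bsub>H\<^esub> h (\<pi> i y)" .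
      then show ?thesis using \<rho>[OF i] xy by simp
    qed
    show "\<rho> j Q = (if j = i then Q else \<zero>\<^bsub>H\<^esub>)" if ij: "i \<in> K" "j \<in> K" and Q: "Q \<in> h ` A i" for i j Q
    proof -
      obtain x where x: "x \<in> A i" "Q = h x" using Q by blast
      show ?thesis
        using \<rho>[OF ij(2) P.A_carrier[OF ij(1) x(1)]] P.proj_homogeneous[OF ij x(1)] x(2) by simp
    qed
    show "\<exists>F\<subseteq>K. finite F \<and> Q = (\<Oplus>\<^bsub>H\<^esub>i\<in>F. \<rho> i Q)" if Q: "Q \<in> carrier H" for Q
    proof -
      obtain x where x: "x \<in> carrier G" "Q = h x" using Q unfolding surj[symmetric] by blast
      obtain F where F: "F \<subseteq> K" "finite F" "x = (\<Oplus>i\<in>F. \<pi> i x)"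
        using P.proj_expand[OF x(1)] by blast
      have "Q = h (\<Oplus>i\<in>F. \<pi> i x)" using x(2) F(3) by simp
      also have "\<dots> = (\<Oplus>\<^bsub>H\<^esub>i\<in>F. h (\<pi> i x))"
        using F P.proj_carrier[OF _ x(1)] by (intro h_finsum) auto
      also have "\<dots> = (\<Oplus>\<^bsub>H\<^esub>i\<in>F. \<rho> i Q)"
        using F(1) x P.proj_carrier[OF _ x(1)] \<rho> by (intro H.finsum_cong') auto
      finally show ?thesis using F(1,2) by blast
    qed
  qed
qed

text \<open>Records a grading through its additive decomposition, with \<open>carrier G\<close> as
  index set, so that the same results serve \<open>R\<close> and its graded quotients.\<close>

locale cring_projections = cring R + homogeneous_projections R "carrier G" A "carrier R" \<pi>
  for G :: "('g, 'x) monoid_scheme" and R :: "('a, 'y) ring_scheme" (structure)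
    and A :: "'g \<Rightarrow> 'a set" and \<pi> :: "'g \<Rightarrow> 'a \<Rightarrow> 'a"
begin

lemma graded_ideal_iff:
  "graded_ideal G R A I \<longleftrightarrow> ideal I R \<and> (\<forall>g\<in>carrier G. \<forall>x\<in>I. \<pi> g x \<in> I)"
  using internal_direct_sum_Int_iff[of I] ideal.axioms(1)[of I R] additive_subgroup.a_subset[of I R]
  unfolding graded_ideal_def by blast

lemma graded_ideal_carrier: "graded_ideal G R A (carrier R)"
  using oneideal proj_carrier unfolding graded_ideal_iff by blast

lemma graded_Spec_ideal: "p \<in> graded_Spec G R A \<Longrightarrow> graded_ideal G R A p"
  unfolding graded_Spec_def graded_prime_def by simp

lemma graded_prime_proper: "p \<in> graded_Spec G R A \<Longrightarrow> p \<subset> carrier R"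
  unfolding graded_Spec_def graded_prime_def graded_ideal_def
  using additive_subgroup.a_subset ideal.axioms(1) by blast

lemma graded_ideal_Inter:
  assumes "\<And>I. I \<in> \<I> \<Longrightarrow> graded_ideal G R A I" "\<I> \<noteq> {}"
  shows "graded_ideal G R A (\<Inter>\<I>)"
  using assms i_Intersect[of \<I>] unfolding graded_ideal_iff by blast

text \<open>The inclusion from left to right uses primeness. Elements of \<open>I\<close> and
  \<open>J\<close> outside \<open>p\<close> have homogeneous components outside \<open>p\<close>;
  gradedness keeps these in \<open>I\<close> and \<open>J\<close>, so their product lies in
  \<open>I \<inter> J\<close> and hence in \<open>p\<close>, a contradiction.\<close>

lemma graded_V_Int:
  assumes "graded_ideal G R A I" "graded_ideal G R A J"
  shows "graded_V G R A (I \<inter> J) = graded_V G R A I \<union> graded_V G R A J"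
proof -
  have "I \<subseteq> p \<or> J \<subseteq> p" if p: "p \<in> graded_Spec G R A" and sub: "I \<inter> J \<subseteq> p" for p
  proof (rule ccontr)
    assume "\<not> (I \<subseteq> p \<or> J \<subseteq> p)"
    then obtain a b where ab: "a \<in> I" "a \<notin> p" "b \<in> J" "b \<notin> p" by blast
    have IJ: "ideal I R" "ideal J R" using assms unfolding graded_ideal_iff by auto
    have ab_car: "a \<in> carrier R" "b \<in> carrier R" 
      using ideal.Icarr[OF IJ(1) ab(1)] ideal.Icarr[OF IJ(2) ab(3)] .
    have pa: "additive_subgroup p R"
      using graded_Spec_ideal[OF p] unfolding graded_ideal_iff by (intro ideal.axioms(1)) simp
    obtain g where g: "g \<in> carrier G" "\<pi> g a \<notin> p"
      using mem_subgroup_if_proj_mem[OF pa ab_car(1)] ab by blast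
    obtain k where k: "k \<in> carrier G" "\<pi> k b \<notin> p"
      using mem_subgroup_if_proj_mem[OF pa ab_car(2)] ab by blast
    have "\<pi> g a \<in> I" "\<pi> k b \<in> J" using assms g k ab unfolding graded_ideal_iff by auto
    then have "\<pi> g a \<otimes> \<pi> k b \<in> I \<inter> J"
      using ideal.I_l_closed[OF IJ(2)] ideal.I_r_closed[OF IJ(1)] proj_carrier[OF g(1) ab_car(1)]
        proj_carrier[OF k(1) ab_car(2)] by simp
    moreover have "\<pi> g a \<in> homogeneous G A" "\<pi> k b \<in> homogeneous G A"
      unfolding homogeneous_def using g(1) k(1) proj_closed ab_car by blast+
    ultimately show False
      using p g(2) k(2) sub unfolding graded_Spec_def graded_prime_def by blast
  qed
  then show ?thesis unfolding graded_V_def by blast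
qed

text \<open>\<open>topology\<close> is known to return the given open sets only after
  \<open>istopology\<close> is checked. Binary intersections are handled by
  \<open>graded_V_Int\<close>, arbitrary unions by an intersection of primes.\<close>

lemma openin_graded_Zariski:
  "openin (graded_Zariski G R A) U \<longleftrightarrow>
    (\<exists>J. graded_ideal G R A J \<and> U = graded_Spec G R A - graded_V G R A J)"
proof -
  define opn where
    "opn U \<longleftrightarrow> (\<exists>J. graded_ideal G R A J \<and> U = graded_Spec G R A - graded_V G R A J)" for U
  have "opn (U \<inter> V)" if U: "opn U" and V: "opn V" for U V
  proof -
    obtain I J where IJ: "graded_ideal G R A I" "U = graded_Spec G R A - graded_V G R A I"
      "graded_ideal G R A J" "V = graded_Spec G R A - graded_V G R A J"
      using U V unfolding opn_def by blast
    have "graded_ideal G R A (I \<inter> J)" using graded_ideal_Inter[of "{I, J}"] IJ by auto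
    moreover have "U \<inter> V = graded_Spec G R A - graded_V G R A (I \<inter> J)"
      unfolding IJ(2,4) graded_V_Int[OF IJ(1,3)] by blast
    ultimately show ?thesis unfolding opn_def by blast
  qed
  moreover have "opn (\<Union>\<U>)" if \<U>: "\<forall>U\<in>\<U>. opn U" for \<U>
  proof -
    obtain j where j: "\<And>U. U \<in> \<U> \<Longrightarrow> graded_ideal G R A (j U)"
      "\<And>U. U \<in> \<U> \<Longrightarrow> U = graded_Spec G R A - graded_V G R A (j U)"
      using \<U> unfolding opn_def by metis
    \<comment> \<open>The intersection of the graded primes above a family of graded ideals defines the same closed
      set as the sum of the family.\<close>
    define P where "P = {p \<in> graded_Spec G R A. \<forall>U\<in>\<U>. j U \<subseteq> p}"
    \<comment> \<open>Inserting \<open>carrier R\<close> keeps the intersection a graded ideal when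
      \<open>P\<close> is empty, and changes nothing otherwise.\<close>
    define J where "J = \<Inter>(insert (carrier R) P)"
    have J: "graded_ideal G R A J"
      unfolding J_def using graded_ideal_carrier graded_Spec_ideal
      by (intro graded_ideal_Inter) (auto simp: P_def)
    have "j U \<subseteq> J" if "U \<in> \<U>" for U
    proof -
      have "j U \<subseteq> carrier R"
        using j(1)[OF that] additive_subgroup.a_subset ideal.axioms(1) unfolding graded_ideal_iff by blast
      then show ?thesis using that unfolding J_def P_def by blast
    qed
    moreover have "J \<subseteq> p" if "p \<in> P" for p using that unfolding J_def by blast
    ultimately have V: "graded_V G R A J = P" unfolding graded_V_def P_def by blast
    have "(\<Union>U\<in>\<U>. U) = (\<Union>U\<in>\<U>. graded_Spec G R A - graded_V G R A (j U))"
      by (rule SUP_cong[OF refl j(2)])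
    also have "\<dots> = graded_Spec G R A - graded_V G R A J"
      unfolding V unfolding P_def graded_V_def by blast
    finally have "\<Union>\<U> = graded_Spec G R A - graded_V G R A J" by simp
    then show ?thesis using J unfolding opn_def by blast
  qed
  ultimately have "istopology opn" unfolding istopology_def by blast
  moreover have "graded_Zariski G R A = topology opn"
    unfolding graded_Zariski_def opn_def ..
  ultimately show ?thesis using opn_def by (simp add: topology_inverse')
qed

text \<open>Primes are proper, so none contains the unit ideal, and the whole spectrum is
  open.\<close>

lemma topspace_graded_Zariski: "topspace (graded_Zariski G R A) = graded_Spec G R A"
proof -
  have "graded_V G R A (carrier R) = {}"
    using graded_prime_proper unfolding graded_V_def by blast
  then have "openin (graded_Zariski G R A) (graded_Spec G R A)"
    unfolding openin_graded_Zariski using graded_ideal_carrier by blast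
  then show ?thesis
    unfolding topspace_def openin_graded_Zariski by blast
qed

end

text \<open>An ideal containing \<open>I\<close> is a union of cosets of \<open>I\<close>, so
  membership does not depend on the representative.\<close>

lemma (in ideal) rcos_mem_image_iff:
  assumes "ideal J R" "I \<subseteq> J" "r \<in> carrier R"
  shows "I +> r \<in> (+>) I ` J \<longleftrightarrow> r \<in> J"
proof
  assume "I +> r \<in> (+>) I ` J"
  then obtain s where s: "s \<in> J" "I +> r = I +> s" by blast
  have sc: "s \<in> carrier R" using s(1) ideal.Icarr[OF assms(1)] by blast
  have "r \<ominus> s \<in> J"
    using quotient_eq_iff_same_a_r_cos[OF is_ideal assms(3) sc] s(2) assms(2) by blast
  moreover have "(r \<ominus> s) \<oplus> s = r"
    using assms(3) sc by (simp add: a_minus_def a_assoc l_neg)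
  ultimately show "r \<in> J"
    using additive_subgroup.a_closed[OF ideal.axioms(1)[OF assms(1)] _ s(1)] by metis
qed blast

text \<open>A graded ideal is stable under the projections, so the kernel condition of
  \<open>image_homogeneous_projections\<close> holds for the quotient map. The image grading
  obtained there is \<open>quotient_grading\<close>.\<close>

lemma (in cring_projections) quotient_projections:
  assumes "graded_ideal G R A I"
  shows "\<exists>\<rho>. cring_projections G (R Quot I) (quotient_grading R I A) \<rho> \<and>
    (\<forall>g\<in>carrier G. \<forall>r\<in>carrier R. \<rho> g (I +> r) = I +> \<pi> g r)"
proof -
  interpret I: ideal I R using assms unfolding graded_ideal_iff by simp
  have zero: "\<zero>\<^bsub>R Quot I\<^esub> = I" unfolding FactRing_def by (rule ring.select_convs)
  interpret h: ring_hom_ring R "R Quot I" "(+>) I" by (rule I.rcos_ring_hom_ring)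
  have surj: "(+>) I ` carrier R = carrier (R Quot I)"
    unfolding FactRing_def A_RCOSETS_def' by auto
  have z: "I +> r = \<zero>\<^bsub>R Quot I\<^esub> \<longleftrightarrow> r \<in> I" if "r \<in> carrier R" for r
  proof -
    have "r \<in> I" if "I +> r = I"
      by (rule I.rcos_const_imp_mem) fact+
    moreover have "I +> r = I" if "r \<in> I"
      by (rule a_rcos_zero[OF I.is_ideal that])
    ultimately show ?thesis unfolding zero by blast
  qed
  have ker: "I +> \<pi> i x = \<zero>\<^bsub>R Quot I\<^esub>"
    if "i \<in> carrier G" "x \<in> carrier R" "I +> x = \<zero>\<^bsub>R Quot I\<^esub>" for i x
  proof -
    have "x \<in> I" using z[OF that(2)] that(3) by blast
    then have "\<pi> i x \<in> I" using assms that(1) unfolding graded_ideal_iff by blast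
    then show ?thesis using z[OF proj_carrier[OF that(1,2)]] by blast
  qed
  have grading: "quotient_grading R I A = (\<lambda>i. (+>) I ` A i)"
    by (simp add: quotient_grading_def fun_eq_iff)
  show ?thesis
  proof (rule h.image_homogeneous_projections[OF homogeneous_projections_axioms surj ker])
    fix \<rho> assume \<rho>: "homogeneous_projections (R Quot I) (carrier G) (\<lambda>i. (+>) I ` A i) (carrier (R Quot I)) \<rho>"
      "\<And>g r. \<lbrakk>g \<in> carrier G; r \<in> carrier R\<rbrakk> \<Longrightarrow> \<rho> g (I +> r) = I +> \<pi> g r"
    have "cring_projections G (R Quot I) (quotient_grading R I A) \<rho>"
      unfolding cring_projections_def grading
      using \<rho>(1) I.quotient_is_cring[OF cring_axioms] by (rule conjI[rotated])
    then show ?thesis using \<rho>(2) by blast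
  qed
qed

text \<open>Closed sets of the pullback are the preimages of closed sets of \<open>T\<close>.
  Surjectivity makes taking preimages an order isomorphism between the two lattices of closed sets,
  with inverse the direct image, so chains correspond.\<close>

lemma noetherian_space_pullback_topology:
  fixes f :: "'a \<Rightarrow> 'b"
  assumes "f ` A = topspace T"
  shows "noetherian_space (pullback_topology A f T) \<longleftrightarrow> noetherian_space T"
proof -
  have top: "topspace (pullback_topology A f T) = A"
    unfolding topspace_pullback_topology using assms by blast
  have closed_iff: "closedin (pullback_topology A f T) C \<longleftrightarrow> (\<exists>D. closedin T D \<and> C = f -` D \<inter> A)" for C
  proof
    assume "closedin (pullback_topology A f T) C"
    then have "C \<subseteq> A" "openin (pullback_topology A f T) (A - C)" unfolding closedin_def top by auto
    then obtain U where U: "openin T U" "A - C = f -` U \<inter> A" unfolding openin_pullback_topology by blast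
    have "f -` topspace T \<inter> A = A" using assms by blast
    then have "C = f -` (topspace T - U) \<inter> A" using U(2) \<open>C \<subseteq> A\<close> by blast
    moreover have "closedin T (topspace T - U)" using U(1) by blast
    ultimately show "\<exists>D. closedin T D \<and> C = f -` D \<inter> A" by blast
  next
    assume "\<exists>D. closedin T D \<and> C = f -` D \<inter> A"
    then obtain D where D: "closedin T D" "C = f -` D \<inter> A" by blast
    have "openin T (topspace T - D)" "A - C = f -` (topspace T - D) \<inter> A"
      using D assms by blast+
    then show "closedin (pullback_topology A f T) C"
      unfolding closedin_def top openin_pullback_topology using D(2) by blast
  qed
  \<comment> \<open>This is where surjectivity enters: a closed set is recovered from its
    preimage.\<close>
  have img: "f ` (f -` D \<inter> A) = D" if "closedin T D" for D
  proof -
    have "D \<subseteq> f ` A" using closedin_subset[OF that] assms by simp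
    then show ?thesis by blast
  qed
  show ?thesis
  proof
    assume N: "noetherian_space (pullback_topology A f T)"
    show "noetherian_space T"
      unfolding noetherian_space_def
    proof (intro allI impI)
      fix D :: "nat \<Rightarrow> 'b set" assume D: "(\<forall>n. closedin T (D n)) \<and> decseq D"
      have "(\<forall>n. closedin (pullback_topology A f T) (f -` D n \<inter> A)) \<and> decseq (\<lambda>n. f -` D n \<inter> A)"
        using D unfolding closed_iff decseq_def by blast
      then obtain m where "\<forall>n\<ge>m. f -` D n \<inter> A = f -` D m \<inter> A"
        using N unfolding noetherian_space_def by meson
      then show "\<exists>m. \<forall>n\<ge>m. D n = D m" using D img by metis
    qed
  next
    assume N: "noetherian_space T"
    show "noetherian_space (pullback_topology A f T)"
      unfolding noetherian_space_def
    proof (intro allI impI)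
      fix C :: "nat \<Rightarrow> 'a set" assume C: "(\<forall>n. closedin (pullback_topology A f T) (C n)) \<and> decseq C"
      then obtain D where D: "\<And>n. closedin T (D n)" "\<And>n. C n = f -` D n \<inter> A"
        unfolding closed_iff by metis
      \<comment> \<open>The sets \<open>D n\<close> were chosen one at a time; writing them as
        images of the \<open>C n\<close> shows that they form a descending chain.\<close>
      have DC: "D n = f ` C n" for n using img D by metis
      have "decseq D" using C unfolding decseq_def DC by blast
      then obtain m where "\<forall>n\<ge>m. D n = D m"
        using N D(1) unfolding noetherian_space_def by meson
      then show "\<exists>m. \<forall>n\<ge>m. C n = C m" using D(2) by metis
    qed
  qed
qed

section \<open>Transfer of graded ideals to and from a quotient ring\<close>

context cring_projections
begin

text \<open>The projections of the quotient act on representatives, so stability passes to the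
  image. With \<open>J\<close> an annihilator this makes the values of \<open>natural_map\<close>
  graded ideals.\<close>

lemma graded_ideal_quotient_image:
  assumes "graded_ideal G R A I" "graded_ideal G R A J"
  shows "graded_ideal G (R Quot I) (quotient_grading R I A) ((+>) I ` J)"
proof -
  obtain \<rho> where "cring_projections G (R Quot I) (quotient_grading R I A) \<rho>"
    and \<rho>: "\<And>g r. \<lbrakk>g \<in> carrier G; r \<in> carrier R\<rbrakk> \<Longrightarrow> \<rho> g (I +> r) = I +> \<pi> g r"
    using quotient_projections[OF assms(1)] by blast
  then interpret Q: cring_projections G "R Quot I" "quotient_grading R I A" \<rho> by blast
  have IJ: "ideal I R" "ideal J R" "\<And>g r. g \<in> carrier G \<Longrightarrow> r \<in> J \<Longrightarrow> \<pi> g r \<in> J"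
    using assms unfolding graded_ideal_iff by blast+
  have "\<rho> g x \<in> (+>) I ` J" if "g \<in> carrier G" "x \<in> (+>) I ` J" for g x
    using that \<rho> IJ(3) ideal.Icarr[OF IJ(2)] by auto
  then show ?thesis
    unfolding Q.graded_ideal_iff using ring_ideal_imp_quot_ideal[OF IJ(1,2)] by blast
qed

text \<open>Lifts the ideal defining a closed set of the quotient's spectrum to \<open>R\<close>,
  where it can act on the module.\<close>

lemma graded_ideal_quotient_preimage:
  assumes "graded_ideal G R A I" "graded_ideal G (R Quot I) (quotient_grading R I A) J"
  shows "graded_ideal G R A {r \<in> carrier R. I +> r \<in> J}"
proof -
  obtain \<rho> where "cring_projections G (R Quot I) (quotient_grading R I A) \<rho>"
    and \<rho>: "\<And>g r. \<lbrakk>g \<in> carrier G; r \<in> carrier R\<rbrakk> \<Longrightarrow> \<rho> g (I +> r) = I +> \<pi> g r"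
    using quotient_projections[OF assms(1)] by blast
  then interpret Q: cring_projections G "R Quot I" "quotient_grading R I A" \<rho> by blast
  have I: "ideal I R" using assms(1) unfolding graded_ideal_iff by blast
  have J: "ideal J (R Quot I)" "\<And>g x. g \<in> carrier G \<Longrightarrow> x \<in> J \<Longrightarrow> \<rho> g x \<in> J"
    using assms(2) unfolding Q.graded_ideal_iff by blast+
  have "I +> \<pi> g r \<in> J" if "g \<in> carrier G" "r \<in> carrier R" "I +> r \<in> J" for g r
    using J(2)[OF that(1,3)] \<rho>[OF that(1,2)] by simp
  then show ?thesis
    unfolding graded_ideal_iff
    using ring_hom_ring.ideal_vimage[OF ideal.rcos_ring_hom_ring[OF I] J(1)] proj_carrier by blast
qed

end

section \<open>The graded second spectrum\<close>

locale graded_module_projections = graded_module G R A M B +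
  R: cring_projections G R A \<pi> + M: homogeneous_projections M "carrier G" B "carrier M" \<sigma>
  for G :: "('g, 'x) monoid_scheme" and R :: "('a, 'y) ring_scheme" and A :: "'g \<Rightarrow> 'a set"
    and M :: "('a, 'b, 'z) module_scheme" and B :: "'g \<Rightarrow> 'b set"
    and \<pi> :: "'g \<Rightarrow> 'a \<Rightarrow> 'a" and \<sigma> :: "'g \<Rightarrow> 'b \<Rightarrow> 'b"
begin

text \<open>Multiplying by \<open>x\<close> of degree \<open>h\<close> shifts degrees by
  \<open>h\<close>, and cancellation in \<open>G\<close> ensures that only the part of
  \<open>r\<close> of degree \<open>g\<close> reaches the product degree. The claim is additive in
  \<open>r\<close>, so homogeneous \<open>r\<close> suffices.\<close>

lemma proj_smult_homogeneous_right:
  assumes g: "g \<in> carrier G" and h: "h \<in> carrier G" and r: "r \<in> carrier R" and x: "x \<in> B h"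
  shows "\<sigma> (g \<otimes>\<^bsub>G\<^esub> h) (r \<odot>\<^bsub>M\<^esub> x) = \<pi> g r \<odot>\<^bsub>M\<^esub> x"
  using r
proof (induction r rule: R.additive_induct)
  case (add r s)
  have xM: "x \<in> carrier M" by (rule M.A_carrier[OF h x])
  have gh: "g \<otimes>\<^bsub>G\<^esub> h \<in> carrier G" by (rule G.m_closed[OF g h])
  have "\<sigma> (g \<otimes>\<^bsub>G\<^esub> h) ((r \<oplus>\<^bsub>R\<^esub> s) \<odot>\<^bsub>M\<^esub> x) = \<sigma> (g \<otimes>\<^bsub>G\<^esub> h) (r \<odot>\<^bsub>M\<^esub> x \<oplus>\<^bsub>M\<^esub> s \<odot>\<^bsub>M\<^esub> x)"
    using smult_l_distr[OF add(1,2) xM] by presburger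
  also have "\<dots> = \<pi> g r \<odot>\<^bsub>M\<^esub> x \<oplus>\<^bsub>M\<^esub> \<pi> g s \<odot>\<^bsub>M\<^esub> x"
    using M.proj_add[OF gh smult_closed[OF add(1) xM] smult_closed[OF add(2) xM]] add(3,4) by presburger
  also have "\<dots> = \<pi> g (r \<oplus>\<^bsub>R\<^esub> s) \<odot>\<^bsub>M\<^esub> x"
    using smult_l_distr[OF R.proj_carrier[OF g add(1)] R.proj_carrier[OF g add(2)] xM]
      R.proj_add[OF g add(1,2)] by presburger
  finally show ?case .
next
  case (homogeneous k r)
  have xM: "x \<in> carrier M" by (rule M.A_carrier[OF h x])
  have gh: "g \<otimes>\<^bsub>G\<^esub> h \<in> carrier G" and kh: "k \<otimes>\<^bsub>G\<^esub> h \<in> carrier G"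
    using G.m_closed g h homogeneous(1) by blast+
  have "g \<otimes>\<^bsub>G\<^esub> h = k \<otimes>\<^bsub>G\<^esub> h \<longleftrightarrow> g = k"
    using G.right_cancel[OF h g homogeneous(1)] by blast
  then show ?case
    using M.proj_homogeneous[OF kh gh module_degree_smult[OF homogeneous(1) h homogeneous(2) x]]
      R.proj_homogeneous[OF homogeneous(1) g homogeneous(2)] smult_l_null[OF xM] by presburger
next
  case zero
  have xM: "x \<in> carrier M" by (rule M.A_carrier[OF h x])
  show ?case
    using smult_l_null[OF xM] R.proj_zero[OF g] M.proj_zero[OF G.m_closed[OF g h]] by presburger
qed

text \<open>The mirror image: now the scalar is homogeneous, and the induction runs over the module
  element.\<close>

lemma proj_smult_homogeneous_left:
  assumes g: "g \<in> carrier G" and h: "h \<in> carrier G" and r: "r \<in> A g" and x: "x \<in> carrier M"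
  shows "\<sigma> (g \<otimes>\<^bsub>G\<^esub> h) (r \<odot>\<^bsub>M\<^esub> x) = r \<odot>\<^bsub>M\<^esub> \<sigma> h x"
  using x
proof (induction x rule: M.additive_induct)
  case (add x y)
  have rR: "r \<in> carrier R" by (rule R.A_carrier[OF g r])
  have gh: "g \<otimes>\<^bsub>G\<^esub> h \<in> carrier G" by (rule G.m_closed[OF g h])
  have "\<sigma> (g \<otimes>\<^bsub>G\<^esub> h) (r \<odot>\<^bsub>M\<^esub> (x \<oplus>\<^bsub>M\<^esub> y)) = \<sigma> (g \<otimes>\<^bsub>G\<^esub> h) (r \<odot>\<^bsub>M\<^esub> x \<oplus>\<^bsub>M\<^esub> r \<odot>\<^bsub>M\<^esub> y)"
    using smult_r_distr[OF rR add(1,2)] by presburger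
  also have "\<dots> = r \<odot>\<^bsub>M\<^esub> \<sigma> h x \<oplus>\<^bsub>M\<^esub> r \<odot>\<^bsub>M\<^esub> \<sigma> h y"
    using M.proj_add[OF gh smult_closed[OF rR add(1)] smult_closed[OF rR add(2)]] add(3,4) by presburger
  also have "\<dots> = r \<odot>\<^bsub>M\<^esub> \<sigma> h (x \<oplus>\<^bsub>M\<^esub> y)"
    using smult_r_distr[OF rR M.proj_carrier[OF h add(1)] M.proj_carrier[OF h add(2)]]
      M.proj_add[OF h add(1,2)] by presburger
  finally show ?case .
next
  case (homogeneous k x)
  have rR: "r \<in> carrier R" by (rule R.A_carrier[OF g r])
  have gh: "g \<otimes>\<^bsub>G\<^esub> h \<in> carrier G" and gk: "g \<otimes>\<^bsub>G\<^esub> k \<in> carrier G"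
    using G.m_closed g h homogeneous(1) by blast+
  have "g \<otimes>\<^bsub>G\<^esub> h = g \<otimes>\<^bsub>G\<^esub> k \<longleftrightarrow> h = k"
    using G.l_cancel[OF _ h homogeneous(1) g] by blast
  then show ?case
    using M.proj_homogeneous[OF gk gh module_degree_smult[OF g homogeneous(1) r homogeneous(2)]]
      M.proj_homogeneous[OF homogeneous(1) h homogeneous(2)] smult_r_null[OF rR] by presburger
next
  case zero
  have rR: "r \<in> carrier R" by (rule R.A_carrier[OF g r])
  show ?case
    using smult_r_null[OF rR] M.proj_zero[OF h] M.proj_zero[OF G.m_closed[OF g h]] by presburger
qed

lemma graded_submodule_iff:
  "graded_submodule G R M B N \<longleftrightarrow> submodule N R M \<and> (\<forall>g\<in>carrier G. \<forall>x\<in>N. \<sigma> g x \<in> N)"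
proof -
  have "additive_subgroup N M" if "submodule N R M"
    using submodule.axioms(1)[OF that] by (rule additive_subgroupI)
  then show ?thesis
    unfolding graded_submodule_def
    using M.internal_direct_sum_Int_iff[of N] submoduleE(1)[of N] by blast
qed

lemma minus_zero_module: "\<ominus>\<^bsub>M\<^esub> \<zero>\<^bsub>M\<^esub> = \<zero>\<^bsub>M\<^esub>"
  by (rule M.minus_equality[OF M.l_zero]) (rule M.zero_closed)+

lemma ideal_Ann:
  assumes "N \<subseteq> carrier M"
  shows "ideal (Ann R M N) R"
proof (rule idealI[OF R.ring_axioms])
  have N: "x \<in> carrier M" if "x \<in> N" for x using that assms by blast
  show "subgroup (Ann R M N) (add_monoid R)"
  proof (rule R.add.subgroupI)
    show "Ann R M N \<subseteq> carrier R" unfolding Ann_def by blast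
    show "Ann R M N \<noteq> {}" unfolding Ann_def using smult_l_null[OF N] R.zero_closed by blast
    show "\<ominus>\<^bsub>R\<^esub> a \<in> Ann R M N" if "a \<in> Ann R M N" for a
      using that smult_l_minus[OF _ N] R.a_inv_closed minus_zero_module unfolding Ann_def by force
    show "a \<oplus>\<^bsub>R\<^esub> b \<in> Ann R M N" if "a \<in> Ann R M N" "b \<in> Ann R M N" for a b
      using that smult_l_distr[OF _ _ N] R.a_closed M.l_zero[OF M.zero_closed] unfolding Ann_def by force
  qed
  show "r \<otimes>\<^bsub>R\<^esub> a \<in> Ann R M N" if a: "a \<in> Ann R M N" and r: "r \<in> carrier R" for a r
    using a r smult_assoc1[OF _ _ N] R.m_closed smult_r_null[OF r] unfolding Ann_def by force
  then show "a \<otimes>\<^bsub>R\<^esub> r \<in> Ann R M N" if "a \<in> Ann R M N" "r \<in> carrier R" for a r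
    using that R.m_comm[of a r] unfolding Ann_def by force
qed

text \<open>The submodule written \<open>(0 : J)\<close>. Here \<open>J\<close> is an arbitrary set
  of scalars because singletons are used as well as ideals; commutativity of \<open>R\<close> gives
  closure under scalars.\<close>

lemma submodule_annihilated:
  assumes "J \<subseteq> carrier R"
  shows "submodule {x \<in> carrier M. \<forall>r\<in>J. r \<odot>\<^bsub>M\<^esub> x = \<zero>\<^bsub>M\<^esub>} R M"
proof (rule submoduleI)
  have J: "r \<in> carrier R" if "r \<in> J" for r using that assms by blast
  let ?N = "{x \<in> carrier M. \<forall>r\<in>J. r \<odot>\<^bsub>M\<^esub> x = \<zero>\<^bsub>M\<^esub>}"
  show "?N \<subseteq> carrier M" by blast
  show "\<zero>\<^bsub>M\<^esub> \<in> ?N" using smult_r_null[OF J] M.zero_closed by blast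
  show "\<ominus>\<^bsub>M\<^esub> x \<in> ?N" if "x \<in> ?N" for x
    using that smult_r_minus[OF J] M.a_inv_closed minus_zero_module by force
  show "x \<oplus>\<^bsub>M\<^esub> y \<in> ?N" if "x \<in> ?N" "y \<in> ?N" for x y
    using that smult_r_distr[OF J] M.a_closed M.l_zero[OF M.zero_closed] by force
  show "a \<odot>\<^bsub>M\<^esub> x \<in> ?N" if a: "a \<in> carrier R" and x: "x \<in> ?N" for a x
  proof -
    have "r \<odot>\<^bsub>M\<^esub> (a \<odot>\<^bsub>M\<^esub> x) = \<zero>\<^bsub>M\<^esub>" if r: "r \<in> J" for r
    proof -
      have "r \<odot>\<^bsub>M\<^esub> (a \<odot>\<^bsub>M\<^esub> x) = (r \<otimes>\<^bsub>R\<^esub> a) \<odot>\<^bsub>M\<^esub> x"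
        using smult_assoc1[OF J[OF r] a] x by force
      also have "\<dots> = a \<odot>\<^bsub>M\<^esub> (r \<odot>\<^bsub>M\<^esub> x)"
        using smult_assoc1[OF a J[OF r]] x R.m_comm[OF a J[OF r]] by force
      also have "\<dots> = \<zero>\<^bsub>M\<^esub>" using x r smult_r_null[OF a] by force
      finally show ?thesis .
    qed
    then show ?thesis using smult_closed[OF a] x by blast
  qed
qed

text \<open>Let \<open>r\<close> kill \<open>N\<close> and let \<open>x\<close> lie in
  \<open>N\<close>. Each component \<open>\<sigma> h x\<close> lies in \<open>N\<close>, and the
  part of \<open>r \<odot> \<sigma> h x = 0\<close> in the product degree of \<open>g\<close> and
  \<open>h\<close> is \<open>\<pi> g r \<odot> \<sigma> h x\<close>. So \<open>\<pi> g r\<close>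
  kills every component of \<open>x\<close>, hence \<open>x\<close>.\<close>

lemma graded_ideal_Ann:
  assumes "graded_submodule G R M B N"
  shows "graded_ideal G R A (Ann R M N)"
  unfolding R.graded_ideal_iff
proof (intro conjI ballI)
  have N: "submodule N R M" "\<And>g x. g \<in> carrier G \<Longrightarrow> x \<in> N \<Longrightarrow> \<sigma> g x \<in> N"
    using assms unfolding graded_submodule_iff by blast+
  have NM: "N \<subseteq> carrier M" by (rule submoduleE(1)[OF N(1)])
  show "ideal (Ann R M N) R" by (rule ideal_Ann[OF NM])
  fix g r assume g: "g \<in> carrier G" and r: "r \<in> Ann R M N"
  have rR: "r \<in> carrier R" using r unfolding Ann_def by blast
  have pR: "\<pi> g r \<in> carrier R" by (rule R.proj_carrier[OF g rR])
  let ?H = "{x \<in> carrier M. \<forall>s\<in>{\<pi> g r}. s \<odot>\<^bsub>M\<^esub> x = \<zero>\<^bsub>M\<^esub>}"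
  have H: "additive_subgroup ?H M"
    by (rule additive_subgroupI, rule submodule.axioms(1)[OF submodule_annihilated]) (use pR in blast)
  have "x \<in> ?H" if x: "x \<in> N" for x
  proof (rule M.mem_subgroup_if_proj_mem[OF H])
    show xM: "x \<in> carrier M" using x NM by blast
    fix h assume h: "h \<in> carrier G"
    have "r \<odot>\<^bsub>M\<^esub> \<sigma> h x = \<zero>\<^bsub>M\<^esub>" using r N(2)[OF h x] unfolding Ann_def by blast
    then have "\<pi> g r \<odot>\<^bsub>M\<^esub> \<sigma> h x = \<zero>\<^bsub>M\<^esub>"
      using proj_smult_homogeneous_right[OF g h rR M.proj_closed[OF h xM]]
        M.proj_zero[OF G.m_closed[OF g h]] by presburger
    then show "\<sigma> h x \<in> ?H" using M.proj_carrier[OF h xM] by blast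
  qed
  then show "\<pi> g r \<in> Ann R M N" unfolding Ann_def using pR by blast
qed

text \<open>Dual to \<open>graded_ideal_Ann\<close>: every \<open>\<pi> g r\<close> with
  \<open>r\<close> in \<open>J\<close> kills \<open>x\<close>, hence kills
  \<open>\<sigma> h x\<close> by comparing degrees, and summing the components of \<open>r\<close>
  shows that \<open>r\<close> kills \<open>\<sigma> h x\<close>.\<close>

lemma graded_submodule_annihilated:
  assumes "graded_ideal G R A J"
  shows "graded_submodule G R M B {x \<in> carrier M. \<forall>r\<in>J. r \<odot>\<^bsub>M\<^esub> x = \<zero>\<^bsub>M\<^esub>}"
  unfolding graded_submodule_iff
proof (intro conjI ballI)
  let ?N = "{x \<in> carrier M. \<forall>r\<in>J. r \<odot>\<^bsub>M\<^esub> x = \<zero>\<^bsub>M\<^esub>}"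
  have J: "ideal J R" "\<And>g r. g \<in> carrier G \<Longrightarrow> r \<in> J \<Longrightarrow> \<pi> g r \<in> J"
    using assms unfolding R.graded_ideal_iff by blast+
  have JR: "J \<subseteq> carrier R" using ideal.Icarr[OF J(1)] by blast
  show "submodule ?N R M" by (rule submodule_annihilated[OF JR])
  fix h x assume h: "h \<in> carrier G" and x: "x \<in> ?N"
  have xM: "x \<in> carrier M" using x by blast
  have sM: "\<sigma> h x \<in> carrier M" by (rule M.proj_carrier[OF h xM])
  have H: "additive_subgroup (Ann R M {\<sigma> h x}) R"
    by (rule ideal.axioms(1)[OF ideal_Ann]) (use sM in blast)
  have "r \<in> Ann R M {\<sigma> h x}" if r: "r \<in> J" for r
  proof (rule R.mem_subgroup_if_proj_mem[OF H])
    show rR: "r \<in> carrier R" using r JR by blast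
    fix g assume g: "g \<in> carrier G"
    have "\<pi> g r \<odot>\<^bsub>M\<^esub> x = \<zero>\<^bsub>M\<^esub>" using x J(2)[OF g r] by blast
    then have "\<pi> g r \<odot>\<^bsub>M\<^esub> \<sigma> h x = \<zero>\<^bsub>M\<^esub>"
      using proj_smult_homogeneous_left[OF g h R.proj_closed[OF g rR] xM]
        M.proj_zero[OF G.m_closed[OF g h]] by presburger
    then show "\<pi> g r \<in> Ann R M {\<sigma> h x}" unfolding Ann_def using R.proj_carrier[OF g rR] by blast
  qed
  then show "\<sigma> h x \<in> ?N" unfolding Ann_def using sM by blast
qed

section \<open>The natural map and its preimages of closed sets\<close>

abbreviation "\<I> \<equiv> Ann R M (carrier M)"
abbreviation "Q \<equiv> R Quot \<I>"
abbreviation "QA \<equiv> quotient_grading R \<I> A"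
abbreviation "Spec\<^sub>s \<equiv> second_Spec G R A M B"

lemma graded_ideal_Ann_carrier: "graded_ideal G R A \<I>"
proof (rule graded_ideal_Ann)
  show "graded_submodule G R M B (carrier M)"
    unfolding graded_submodule_iff using carrier_is_submodule M.proj_carrier by blast
qed

lemma Ann_carrier_subset:
  "N \<subseteq> carrier M \<Longrightarrow> \<I> \<subseteq> Ann R M N"
  unfolding Ann_def by blast

lemma second_Spec_graded_submodule: "S \<in> Spec\<^sub>s \<Longrightarrow> graded_submodule G R M B S"
  unfolding second_Spec_def graded_second_def by blast

lemma graded_submodule_carrier: "graded_submodule G R M B N \<Longrightarrow> N \<subseteq> carrier M"
  unfolding graded_submodule_iff by (intro submoduleE(1)) blast

lemma rcos_mem_natural_map_iff:
  assumes "S \<subseteq> carrier M" "r \<in> carrier R"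
  shows "\<I> +>\<^bsub>R\<^esub> r \<in> natural_map R M S \<longleftrightarrow> r \<in> Ann R M S"
  unfolding natural_map_def
  using ideal.rcos_mem_image_iff[OF ideal_Ann[OF subset_refl] ideal_Ann[OF assms(1)]
      Ann_carrier_subset[OF assms(1)] assms(2)] .

text \<open>The annihilator of a graded second submodule is a graded prime containing
  \<open>\<I>\<close>. Primeness passes to the quotient because homogeneous elements there are
  cosets of homogeneous elements.\<close>

lemma natural_map_mem_graded_Spec:
  assumes S: "S \<in> Spec\<^sub>s"
  shows "natural_map R M S \<in> graded_Spec G Q QA"
proof -
  have gS: "graded_submodule G R M B S" by (rule second_Spec_graded_submodule[OF S])
  have SM: "S \<subseteq> carrier M" by (rule graded_submodule_carrier[OF gS])
  have S0: "S \<noteq> {\<zero>\<^bsub>M\<^esub>}" "S \<noteq> {}"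
    and second: "\<And>r. r \<in> homogeneous G A \<Longrightarrow>
      (\<lambda>x. r \<odot>\<^bsub>M\<^esub> x) ` S = S \<or> (\<lambda>x. r \<odot>\<^bsub>M\<^esub> x) ` S = {\<zero>\<^bsub>M\<^esub>}"
    using S gS submoduleE(2) unfolding second_Spec_def graded_second_def graded_submodule_def by blast+
  have I: "ideal \<I> R" by (rule ideal_Ann) blast
  have hom: "a \<in> carrier R" if "a \<in> homogeneous G A" for a
    using that R.A_carrier unfolding homogeneous_def by blast
  have prime: "a \<in> Ann R M S \<or> b \<in> Ann R M S"
    if a: "a \<in> homogeneous G A" and b: "b \<in> homogeneous G A" and ab: "a \<otimes>\<^bsub>R\<^esub> b \<in> Ann R M S" for a b
  \<comment> \<open>If \<open>b\<close> maps \<open>S\<close> onto itself, then \<open>a\<close>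
    acts on \<open>S\<close> through values of the product \<open>a b\<close>, which are zero;
    otherwise secondness says that \<open>b\<close> kills \<open>S\<close>.\<close>
  proof (cases "(\<lambda>x. b \<odot>\<^bsub>M\<^esub> x) ` S = S")
    case True
    have "a \<odot>\<^bsub>M\<^esub> x = \<zero>\<^bsub>M\<^esub>" if x: "x \<in> S" for x
    proof -
      obtain y where y: "y \<in> S" "x = b \<odot>\<^bsub>M\<^esub> y" using True x by blast
      have "a \<odot>\<^bsub>M\<^esub> x = (a \<otimes>\<^bsub>R\<^esub> b) \<odot>\<^bsub>M\<^esub> y"
        unfolding y(2) by (rule smult_assoc1[symmetric, OF hom[OF a] hom[OF b]]) (use y SM in blast)
      then show ?thesis using ab y(1) unfolding Ann_def by force
    qed
    then show ?thesis using hom[OF a] unfolding Ann_def by blast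
  next
    case False
    then have "(\<lambda>x. b \<odot>\<^bsub>M\<^esub> x) ` S = {\<zero>\<^bsub>M\<^esub>}" using second[OF b] by blast
    then show ?thesis using hom[OF b] unfolding Ann_def by blast
  qed
  \<comment> \<open>Properness: if the unit killed \<open>S\<close>, the nonempty set
    \<open>S\<close> would be the zero submodule. The coset of the unit then witnesses that the
    image is not all of \<open>Q\<close>.\<close>
  have one: "\<one>\<^bsub>R\<^esub> \<notin> Ann R M S"
  proof
    assume "\<one>\<^bsub>R\<^esub> \<in> Ann R M S"
    then have "x = \<zero>\<^bsub>M\<^esub>" if "x \<in> S" for x
      using that smult_one[of x] SM unfolding Ann_def by force
    then show False using S0 by blast
  qed
  have carQ: "\<I> +>\<^bsub>R\<^esub> r \<in> carrier Q" if "r \<in> carrier R" for r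
    using that unfolding FactRing_def A_RCOSETS_def' by auto
  have "natural_map R M S \<noteq> carrier Q"
    using rcos_mem_natural_map_iff[OF SM R.one_closed] one carQ[OF R.one_closed] by blast
  moreover have "x \<in> natural_map R M S \<or> y \<in> natural_map R M S"
    if x: "x \<in> homogeneous G QA" and y: "y \<in> homogeneous G QA"
      and xy: "x \<otimes>\<^bsub>Q\<^esub> y \<in> natural_map R M S" for x y
  proof -
    obtain a where a: "a \<in> homogeneous G A" "x = \<I> +>\<^bsub>R\<^esub> a"
      using x unfolding homogeneous_def quotient_grading_def by blast
    obtain b where b: "b \<in> homogeneous G A" "y = \<I> +>\<^bsub>R\<^esub> b"
      using y unfolding homogeneous_def quotient_grading_def by blast
    have "x \<otimes>\<^bsub>Q\<^esub> y = \<I> +>\<^bsub>R\<^esub> (a \<otimes>\<^bsub>R\<^esub> b)"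
      unfolding a(2) b(2) by (rule ring_hom_mult[symmetric, OF ideal.rcos_ring_hom[OF I] hom[OF a(1)] hom[OF b(1)]])
    then have "a \<otimes>\<^bsub>R\<^esub> b \<in> Ann R M S"
      using xy rcos_mem_natural_map_iff[OF SM R.m_closed[OF hom[OF a(1)] hom[OF b(1)]]] by presburger
    then show ?thesis
      using prime[OF a(1) b(1)] rcos_mem_natural_map_iff[OF SM hom[OF a(1)]]
        rcos_mem_natural_map_iff[OF SM hom[OF b(1)]] unfolding a(2) b(2) by blast
  qed
  moreover have "graded_ideal G Q QA (natural_map R M S)"
    unfolding natural_map_def
    by (rule R.graded_ideal_quotient_image[OF graded_ideal_Ann_carrier graded_ideal_Ann[OF gS]])
  ultimately show ?thesis unfolding graded_Spec_def graded_prime_def by blast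
qed

text \<open>Containment of ideals in \<open>Q\<close> is tested on representatives, which turns the
  preimage of a closed set into a condition on annihilators in \<open>R\<close>.\<close>

lemma natural_map_preimage_V:
  assumes "graded_ideal G Q QA J"
  shows "natural_map R M -` graded_V G Q QA J \<inter> Spec\<^sub>s =
    {S \<in> Spec\<^sub>s. {r \<in> carrier R. \<I> +>\<^bsub>R\<^esub> r \<in> J} \<subseteq> Ann R M S}"
proof -
  have "J \<subseteq> carrier Q"
    using assms additive_subgroup.a_subset[OF ideal.axioms(1)] unfolding graded_ideal_def by blast
  then have J: "\<exists>r\<in>carrier R. x = \<I> +>\<^bsub>R\<^esub> r" if "x \<in> J" for x
    using that unfolding FactRing_def A_RCOSETS_def' by auto
  have "J \<subseteq> natural_map R M S \<longleftrightarrow> {r \<in> carrier R. \<I> +>\<^bsub>R\<^esub> r \<in> J} \<subseteq> Ann R M S"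
    if S: "S \<in> Spec\<^sub>s" for S
  proof -
    note iff = rcos_mem_natural_map_iff[OF graded_submodule_carrier[OF second_Spec_graded_submodule[OF S]]]
    show ?thesis
    proof
      assume "J \<subseteq> natural_map R M S"
      then show "{r \<in> carrier R. \<I> +>\<^bsub>R\<^esub> r \<in> J} \<subseteq> Ann R M S" using iff by blast
    next
      assume sub: "{r \<in> carrier R. \<I> +>\<^bsub>R\<^esub> r \<in> J} \<subseteq> Ann R M S"
      show "J \<subseteq> natural_map R M S"
      proof
        fix x assume x: "x \<in> J"
        obtain r where r: "r \<in> carrier R" "x = \<I> +>\<^bsub>R\<^esub> r" using J[OF x] by blast
        then have "r \<in> Ann R M S" using sub x by blast
        then show "x \<in> natural_map R M S" using iff[OF r(1)] r(2) by blast
      qed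
    qed
  qed
  then show ?thesis
    using natural_map_mem_graded_Spec unfolding graded_V_def by blast
qed

text \<open>The defining ideal is the image of \<open>Ann R M N\<close> in \<open>Q\<close>;
  \<open>natural_map\<close> is applied to \<open>N\<close> merely as a formula, without
  \<open>N\<close> being second.\<close>

lemma second_V_eq_preimage:
  assumes N: "graded_submodule G R M B N"
  shows "second_V G R A M B N =
    natural_map R M -` graded_V G Q QA (natural_map R M N) \<inter> Spec\<^sub>s"
proof -
  have "graded_ideal G Q QA (natural_map R M N)"
    unfolding natural_map_def
    by (rule R.graded_ideal_quotient_image[OF graded_ideal_Ann_carrier graded_ideal_Ann[OF N]])
  moreover have "{r \<in> carrier R. \<I> +>\<^bsub>R\<^esub> r \<in> natural_map R M N} = Ann R M N"
    using rcos_mem_natural_map_iff[OF graded_submodule_carrier[OF N]] unfolding Ann_def by blast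
  ultimately show ?thesis
    using natural_map_preimage_V unfolding second_V_def by presburger
qed

text \<open>Converse to \<open>second_V_eq_preimage\<close>. The witness is the submodule
  annihilated by the lift of \<open>J\<close> to \<open>R\<close>, and the equality comes from the
  Galois connection between ideals and annihilated submodules.\<close>

lemma preimage_V_eq_second_V:
  assumes J: "graded_ideal G Q QA J"
  obtains N where "graded_submodule G R M B N"
    and "natural_map R M -` graded_V G Q QA J \<inter> Spec\<^sub>s = second_V G R A M B N"
proof
  let ?J = "{r \<in> carrier R. \<I> +>\<^bsub>R\<^esub> r \<in> J}"
  let ?N = "{x \<in> carrier M. \<forall>r\<in>?J. r \<odot>\<^bsub>M\<^esub> x = \<zero>\<^bsub>M\<^esub>}"
  show "graded_submodule G R M B ?N"
    by (rule graded_submodule_annihilated[OF R.graded_ideal_quotient_preimage[OF graded_ideal_Ann_carrier J]])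
  \<comment> \<open>Forwards, \<open>S\<close> lies in \<open>?N\<close> and annihilators reverse
    inclusions. Backwards, \<open>?J\<close> annihilates \<open>?N\<close> by construction.\<close>
  have "?J \<subseteq> Ann R M S \<longleftrightarrow> Ann R M ?N \<subseteq> Ann R M S" if S: "S \<in> Spec\<^sub>s" for S
  proof
    have SM: "S \<subseteq> carrier M" by (rule graded_submodule_carrier[OF second_Spec_graded_submodule[OF S]])
    assume "?J \<subseteq> Ann R M S"
    then have "S \<subseteq> ?N" using SM unfolding Ann_def by blast
    then show "Ann R M ?N \<subseteq> Ann R M S" unfolding Ann_def by blast
  next
    have "?J \<subseteq> Ann R M ?N" unfolding Ann_def by blast
    moreover assume "Ann R M ?N \<subseteq> Ann R M S"
    ultimately show "?J \<subseteq> Ann R M S" by (rule subset_trans)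
  qed
  then show "natural_map R M -` graded_V G Q QA J \<inter> Spec\<^sub>s = second_V G R A M B ?N"
    unfolding natural_map_preimage_V[OF J] second_V_def by (intro Collect_cong conj_cong refl)
qed

text \<open>Both sides are \<open>topology\<close> of a predicate, so it suffices that the
  predicates agree; the two preceding lemmas give the two directions. That the sets declared open in
  the second spectrum form a topology is thereby inherited from the pullback.\<close>

lemma second_Zariski_eq_pullback:
  "second_Zariski G R A M B = pullback_topology Spec\<^sub>s (natural_map R M) (graded_Zariski G Q QA)"
proof -
  obtain \<rho> where "cring_projections G Q QA \<rho>"
    using R.quotient_projections[OF graded_ideal_Ann_carrier] by blast
  then have openin_iff: "openin (graded_Zariski G Q QA) U \<longleftrightarrow>
      (\<exists>J. graded_ideal G Q QA J \<and> U = graded_Spec G Q QA - graded_V G Q QA J)" for U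
    by (rule cring_projections.openin_graded_Zariski)
  \<comment> \<open>Complements commute with preimages because the natural map sends the second
    spectrum into \<open>graded_Spec G Q QA\<close>.\<close>
  have preimage: "natural_map R M -` (graded_Spec G Q QA - V) \<inter> Spec\<^sub>s =
      Spec\<^sub>s - (natural_map R M -` V \<inter> Spec\<^sub>s)" for V
    using natural_map_mem_graded_Spec by blast
  have "(\<exists>N. graded_submodule G R M B N \<and> U = Spec\<^sub>s - second_V G R A M B N) \<longleftrightarrow>
    (\<exists>V. openin (graded_Zariski G Q QA) V \<and> U = natural_map R M -` V \<inter> Spec\<^sub>s)" (is "?L \<longleftrightarrow> ?R") for U
  proof
    assume ?L
    then obtain N where N: "graded_submodule G R M B N" "U = Spec\<^sub>s - second_V G R A M B N" by blast
    have "graded_ideal G Q QA (natural_map R M N)"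
      unfolding natural_map_def
      by (rule R.graded_ideal_quotient_image[OF graded_ideal_Ann_carrier graded_ideal_Ann[OF N(1)]])
    then have "openin (graded_Zariski G Q QA)
        (graded_Spec G Q QA - graded_V G Q QA (natural_map R M N))"
      unfolding openin_iff by blast
    then show ?R
      unfolding N(2) second_V_eq_preimage[OF N(1)] preimage[symmetric] by blast
  next
    assume ?R
    then obtain J where J: "graded_ideal G Q QA J"
      "U = natural_map R M -` (graded_Spec G Q QA - graded_V G Q QA J) \<inter> Spec\<^sub>s"
      unfolding openin_iff by blast
    obtain N where "graded_submodule G R M B N"
      "natural_map R M -` graded_V G Q QA J \<inter> Spec\<^sub>s = second_V G R A M B N"
      by (rule preimage_V_eq_second_V[OF J(1)])
    then show ?L unfolding J(2) preimage by blast
  qed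
  then show ?thesis unfolding second_Zariski_def pullback_topology_def by presburger
qed

text \<open>Secondfulness is the surjectivity onto the underlying space that
  \<open>noetherian_space_pullback_topology\<close> requires.\<close>

lemma noetherian_second_Zariski_iff:
  assumes "graded_secondful G R A M B"
  shows "noetherian_space (second_Zariski G R A M B) \<longleftrightarrow> noetherian_space (graded_Zariski G Q QA)"
proof -
  obtain \<rho> where "cring_projections G Q QA \<rho>"
    using R.quotient_projections[OF graded_ideal_Ann_carrier] by blast
  then have "topspace (graded_Zariski G Q QA) = graded_Spec G Q QA"
    by (rule cring_projections.topspace_graded_Zariski)
  also have "\<dots> = natural_map R M ` Spec\<^sub>s"
  proof
    show "graded_Spec G Q QA \<subseteq> natural_map R M ` Spec\<^sub>s"
      using assms unfolding graded_secondful_def by fast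
    show "natural_map R M ` Spec\<^sub>s \<subseteq> graded_Spec G Q QA"
      using natural_map_mem_graded_Spec by (rule image_subsetI)
  qed
  finally show ?thesis
    unfolding second_Zariski_eq_pullback by (intro noetherian_space_pullback_topology) (rule sym)
qed

end

theorem theorem4p5:
  fixes G :: "('g, 'x) monoid_scheme"
    and R :: "('a, 'y) ring_scheme" and A :: "'g \<Rightarrow> 'a set"
    and M :: "('a, 'b, 'z) module_scheme" and B :: "'g \<Rightarrow> 'b set"
  assumes "graded_module G R A M B"
    and "graded_secondful G R A M B"
  shows "noetherian_space (second_Zariski G R A M B) \<longleftrightarrow>
         noetherian_space (graded_Zariski G (R Quot Ann R M (carrier M))
                             (quotient_grading R (Ann R M (carrier M)) A))"
proof -
  interpret graded_module G R A M B by fact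
  \<comment> \<open>Fixing projections for the gradings of \<open>R\<close> and \<open>M\<close>
    enters the locale in which the equivalence is proved; they do not occur in the
    conclusion.\<close>
  obtain \<pi> where "homogeneous_projections R (carrier G) A (carrier R) \<pi>"
    using R.internal_direct_sum_imp_projections[OF ring_direct_sum] by blast
  moreover obtain \<sigma> where "homogeneous_projections M (carrier G) B (carrier M) \<sigma>"
    using internal_direct_sum_imp_projections[OF module_direct_sum] by blast
  ultimately have "graded_module_projections G R A M B \<pi> \<sigma>"
    using assms(1) R.is_cring by (simp add: graded_module_projections_def cring_projections_def)
  then show ?thesis
    using assms(2) by (rule graded_module_projections.noetherian_second_Zariski_iff)
qed

end
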